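(* Assume $\mathrm{MA}(\omega_1)$. Let $K$ and $L$ be compact lines and $\phi:K\to L$ be a continuous increasing surjection. Assume that $L$ is separable and Borel regular. If $\phi$ has the $c_0$-extension property, then $\phi$ is of countable type.
   Context: $\mathrm{MA}(\omega_1)$ is Martin's axiom for $\omega_1$: for every nonempty partially ordered set $P$ satisfying the countable chain condition and every family of at most $\omega_1$ dense subsets of $P$, there is a filter in $P$ meeting every member of the family. A compact line is a linearly ordered set which is compact in its order topology. "Increasing" means order-preserving in the weak sense. "Countable" means finite or countably infinite. For a compact Hausdorff space $K$, $C(K)$ is the Banach space of continuous real-valued functions on $K$ with the supremum norm. A closed subspace $Y$ of a Banach space $X$ has the $c_0$-extension property in $X$ if every bounded operator $Y\to c_0$ admits a bounded extension $X\to c_0$. For a continuous increasing surjection $\phi:K\to L$ between compact lines, let $\phi^*:C(L)\to C(K)$, $\phi^*(f)=f\circ\phi$; $\phi$ is said to have the $c_0$-extension property if the range $\phi^*C(L)$ has the $c_0$-extension property in $C(K)$. A point $x$ of a linearly ordered set $X$ is internal if it is neither the minimum nor the maximum of $X$, for every $y\in X$ with $y>x$ the interval $]x,y[$ is nonempty, and for every $y\in X$ with $y<x$ the interval $]y,x[$ is nonempty. Let $Q(\phi)=\{t\in L: |\phi^{-1}(t)|>1\}$ and $Q_0(\phi)=\{t\in Q(\phi): t \text{ is an internal point of } L\}$. The map $\phi$ is of countable type if $Q_0(\phi)$ is countable. A separable compact line $L$ is Borel regular if its set of internal points is a Borel subset of $L$. *)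

theory Defs
  imports "HOL-Analysis.Analysis"
begin

unbundle cardinal_syntax

section \<open>Martin's axiom\<close>

text \<open>Posets are carrier sets \<open>P\<close> with a relation \<open>r\<close> satisfying \<^const>\<open>partial_order_on\<close>;
  \<open>(p, q) \<in> r\<close> means that \<open>p\<close> is below (stronger than) \<open>q\<close>.\<close>

definition compatible_in :: "'p set \<Rightarrow> 'p rel \<Rightarrow> 'p \<Rightarrow> 'p \<Rightarrow> bool" where
  "compatible_in P r p q \<longleftrightarrow> (\<exists>s\<in>P. (s, p) \<in> r \<and> (s, q) \<in> r)"

definition ccc :: "'p set \<Rightarrow> 'p rel \<Rightarrow> bool" where
  "ccc P r \<longleftrightarrow>
     (\<forall>A. A \<subseteq> P \<and> (\<forall>p\<in>A. \<forall>q\<in>A. p \<noteq> q \<longrightarrow> \<not> compatible_in P r p q) \<longrightarrow> countable A)"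

definition dense_in_poset :: "'p set \<Rightarrow> 'p rel \<Rightarrow> 'p set \<Rightarrow> bool" where
  "dense_in_poset P r D \<longleftrightarrow> D \<subseteq> P \<and> (\<forall>p\<in>P. \<exists>d\<in>D. (d, p) \<in> r)"

definition poset_filter :: "'p set \<Rightarrow> 'p rel \<Rightarrow> 'p set \<Rightarrow> bool" where
  "poset_filter P r G \<longleftrightarrow> G \<noteq> {} \<and> G \<subseteq> P \<and>
     (\<forall>p\<in>G. \<forall>q\<in>P. (p, q) \<in> r \<longrightarrow> q \<in> G) \<and>
     (\<forall>p\<in>G. \<forall>q\<in>G. \<exists>s\<in>G. (s, p) \<in> r \<and> (s, q) \<in> r)"

text \<open>\<open>MA_omega1 TYPE('p)\<close> is Martin's axiom for posets whose elements have type \<open>'p\<close>; the cardinal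
  \<^term>\<open>cardSuc natLeq\<close> is \<open>\<omega>\<^sub>1\<close>. HOL cannot quantify over all types inside a formula, but by the
  theorem \<open>MA_omega1_nat_set\<close> below, the instance at \<^typ>\<open>nat set\<close> implies the instance at every
  type, so it expresses the full axiom.\<close>

definition MA_omega1 :: "'p itself \<Rightarrow> bool" where
  "MA_omega1 (_ :: 'p itself) \<longleftrightarrow>
     (\<forall>(P :: 'p set) r \<D>.
        P \<noteq> {} \<and> partial_order_on P r \<and> ccc P r \<and>
        |\<D>| \<le>o cardSuc natLeq \<and> (\<forall>D\<in>\<D>. dense_in_poset P r D) \<longrightarrow>
        (\<exists>G. poset_filter P r G \<and> (\<forall>D\<in>\<D>. G \<inter> D \<noteq> {})))"

lemma omega1_closure:
  fixes P :: "'q set" and F :: "'i \<Rightarrow> 'q \<Rightarrow> 'q" and g :: "'q \<Rightarrow> 'q \<Rightarrow> 'q"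
  assumes p0: "p0 \<in> P" and I: "|I| \<le>o cardSuc natLeq"
    and F: "\<And>i p. i \<in> I \<Longrightarrow> p \<in> P \<Longrightarrow> F i p \<in> P"
    and g: "\<And>p q. p \<in> P \<Longrightarrow> q \<in> P \<Longrightarrow> g p q \<in> P"
  obtains S where "p0 \<in> S" "S \<subseteq> P" "|S| \<le>o cardSuc natLeq"
    "\<And>i p. i \<in> I \<Longrightarrow> p \<in> S \<Longrightarrow> F i p \<in> S"
    "\<And>p q. p \<in> S \<Longrightarrow> q \<in> S \<Longrightarrow> g p q \<in> S"
proof -
  let ?O = "cardSuc natLeq"
  have CO: "Card_order ?O" by (simp add: cardSuc_Card_order natLeq_Card_order)
  have inf: "\<not> finite (Field ?O)"
    using Cinfinite_cardSuc[OF natLeq_Cinfinite] by (simp add: cinfinite_def)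
  define st where "st X = X \<union> (\<Union>i\<in>I. F i ` X) \<union> (\<Union>p\<in>X. g p ` X)" for X
  define X where "X n = (st ^^ n) {p0}" for n
  have Suc: "X (Suc n) = st (X n)" for n by (simp add: X_def)
  have X0: "X 0 = {p0}" by (simp add: X_def)
  have im: "|h ` A| \<le>o ?O" if "|A| \<le>o ?O" for h :: "'q \<Rightarrow> 'q" and A
    using card_of_image that by (rule ordLeq_transitive)
  have sub: "X n \<subseteq> P" for n
    by (induction n) (use p0 F g in \<open>auto simp: X0 Suc st_def\<close>, blast+)
  have card: "|X n| \<le>o ?O" for n
  proof (induction n)
    case 0
    have "Field ?O \<noteq> {}" using inf by force
    then have "|{p0}| \<le>o |Field ?O|" by (rule card_of_singl_ordLeq)
    then show ?case unfolding X0
      using card_of_Field_ordIso[OF CO] ordLeq_ordIso_trans by blast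
  next
    case (Suc n)
    have "|\<Union>i\<in>I. F i ` X n| \<le>o ?O" "|\<Union>p\<in>X n. g p ` X n| \<le>o ?O"
      using Suc I im by (auto intro!: card_of_UNION_ordLeq_infinite_Field[OF inf CO])
    then show ?case unfolding \<open>X (Suc n) = st (X n)\<close> st_def
      using Suc by (intro card_of_Un_ordLeq_infinite_Field[OF inf]) (auto intro: CO)
  qed
  have mono: "X m \<subseteq> X n" if "m \<le> n" for m n
    using that by (induction rule: dec_induct) (auto simp: Suc st_def)
  show thesis
  proof (rule that[of "\<Union>n. X n"])
    show "p0 \<in> (\<Union>n. X n)" using X0 by blast
    show "(\<Union>n. X n) \<subseteq> P" using sub by blast
    have "|UNIV :: nat set| \<le>o ?O"
      using ordIso_ordLeq_trans[OF card_of_nat cardSuc_ordLeq[OF natLeq_Card_order]] .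
    then show "|\<Union>n. X n| \<le>o ?O"
      using card by (auto intro!: card_of_UNION_ordLeq_infinite_Field[OF inf CO])
    show "F i p \<in> (\<Union>n. X n)" if "i \<in> I" "p \<in> (\<Union>n. X n)" for i p
    proof -
      obtain n where "p \<in> X n" using \<open>p \<in> (\<Union>n. X n)\<close> by blast
      then have "F i p \<in> X (Suc n)" using that by (auto simp: Suc st_def)
      then show ?thesis by blast
    qed
    show "g p q \<in> (\<Union>n. X n)" if pq: "p \<in> (\<Union>n. X n)" "q \<in> (\<Union>n. X n)" for p q
    proof -
      obtain m n where "p \<in> X m" "q \<in> X n" using pq by blast
      then have "p \<in> X (max m n)" "q \<in> X (max m n)"
        using mono[of m "max m n"] mono[of n "max m n"] by auto
      then have "g p q \<in> X (Suc (max m n))" by (auto simp: Suc st_def)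
      then show ?thesis by blast
    qed
  qed
qed

theorem MA_omega1_nat_set:
  assumes MA: "MA_omega1 TYPE(nat set)"
  shows "MA_omega1 TYPE('q)"
  unfolding MA_omega1_def
proof (intro allI impI; elim conjE)
  fix P :: "'q set" and r \<D>
  assume ne: "P \<noteq> {}" and po: "partial_order_on P r" and ccc: "ccc P r"
    and card: "|\<D>| \<le>o cardSuc natLeq" and dense: "\<forall>D\<in>\<D>. dense_in_poset P r D"
  have rP: "r \<subseteq> P \<times> P" and refl: "\<And>p. p \<in> P \<Longrightarrow> (p, p) \<in> r"
    and trans: "\<And>a b c. (a, b) \<in> r \<Longrightarrow> (b, c) \<in> r \<Longrightarrow> (a, c) \<in> r"
    and antisym: "\<And>a b. (a, b) \<in> r \<Longrightarrow> (b, a) \<in> r \<Longrightarrow> a = b"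
    using po by (auto simp: partial_order_on_def preorder_on_def refl_on_def
        dest: transD antisymD)
  obtain p0 where p0: "p0 \<in> P" using ne by blast
  define F where "F D p = (SOME d. d \<in> D \<and> (d, p) \<in> r)" for D p
  define g where "g p q = (if compatible_in P r p q
      then SOME s. s \<in> P \<and> (s, p) \<in> r \<and> (s, q) \<in> r else p)" for p q
  have F: "F D p \<in> D \<and> (F D p, p) \<in> r" if "D \<in> \<D>" "p \<in> P" for D p
    unfolding F_def by (rule someI_ex) (use dense that in \<open>unfold dense_in_poset_def, blast\<close>)
  have FP: "F D p \<in> P" if "D \<in> \<D>" "p \<in> P" for D p
    using F[OF that] rP by blast
  have g: "g p q \<in> P \<and> (g p q, p) \<in> r \<and> (g p q, q) \<in> r" if "compatible_in P r p q" for p q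
  proof -
    have "\<exists>s. s \<in> P \<and> (s, p) \<in> r \<and> (s, q) \<in> r"
      using that by (auto simp: compatible_in_def)
    from someI_ex[OF this] show ?thesis using that by (simp add: g_def)
  qed
  have gP: "g p q \<in> P" if "p \<in> P" "q \<in> P" for p q
    using g[of p q] that by (cases "compatible_in P r p q") (auto simp: g_def)
  obtain S where S: "p0 \<in> S" "S \<subseteq> P" "|S| \<le>o cardSuc natLeq"
    and FS: "\<And>D p. D \<in> \<D> \<Longrightarrow> p \<in> S \<Longrightarrow> F D p \<in> S"
    and gS: "\<And>p q. p \<in> S \<Longrightarrow> q \<in> S \<Longrightarrow> g p q \<in> S"
    by (rule omega1_closure[where F = F and g = g, OF p0 card FP gP]) blast+
  have comp: "\<exists>s\<in>S. (s, p) \<in> r \<and> (s, q) \<in> r"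
    if "p \<in> S" "q \<in> S" "compatible_in P r p q" for p q
    using g[OF that(3)] gS[OF that(1,2)] by blast
  have "|S| \<le>o |Field (cardSuc natLeq)|"
    using S(3) card_of_Field_ordIso[OF cardSuc_Card_order[OF natLeq_Card_order]]
      ordIso_symmetric ordLeq_ordIso_trans by blast
  then obtain h :: "'q \<Rightarrow> nat set" where h: "inj_on h S"
    using card_of_ordLeq by metis
  define r' where "r' = {(h a, h b) | a b. a \<in> S \<and> b \<in> S \<and> (a, b) \<in> r}"
  define \<D>' where "\<D>' = (\<lambda>D. h ` (D \<inter> S)) ` \<D>"
  have r': "(h a, h b) \<in> r' \<longleftrightarrow> (a, b) \<in> r" if "a \<in> S" "b \<in> S" for a b
    unfolding r'_def using that by (auto simp: inj_on_eq_iff[OF h])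
  have "h ` S \<noteq> {}" using S(1) by blast
  moreover have "partial_order_on (h ` S) r'"
    unfolding partial_order_on_def preorder_on_def refl_on_def
  proof (intro conjI)
    show "r' \<subseteq> h ` S \<times> h ` S" by (auto simp: r'_def)
    show "\<forall>x\<in>h ` S. (x, x) \<in> r'" using S(2) refl r' by auto
    show "Relation.trans r'"
    proof (rule transI)
      fix x y z assume "(x, y) \<in> r'" "(y, z) \<in> r'"
      then obtain a b c where "a \<in> S" "b \<in> S" "c \<in> S" "x = h a" "y = h b" "z = h c"
        by (auto simp: r'_def)
      with \<open>(x, y) \<in> r'\<close> \<open>(y, z) \<in> r'\<close> show "(x, z) \<in> r'"
        using trans by (auto simp: r')
    qed
    show "Relation.antisym r'"
    proof (rule antisymI)
      fix x y assume "(x, y) \<in> r'" "(y, x) \<in> r'"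
      moreover then obtain a b where "a \<in> S" "b \<in> S" "x = h a" "y = h b"
        by (auto simp: r'_def)
      ultimately show "x = y" using antisym by (auto simp: r')
    qed
  qed
  moreover have "ccc (h ` S) r'"
    unfolding ccc_def
  proof (intro allI impI; elim conjE)
    fix A assume A: "A \<subseteq> h ` S"
      and anti: "\<forall>p\<in>A. \<forall>q\<in>A. p \<noteq> q \<longrightarrow> \<not> compatible_in (h ` S) r' p q"
    define B where "B = {s\<in>S. h s \<in> A}"
    have "\<not> compatible_in P r p q" if pq: "p \<in> B" "q \<in> B" "p \<noteq> q" for p q
    proof
      assume "compatible_in P r p q"
      then obtain s where "s \<in> S" "(s, p) \<in> r" "(s, q) \<in> r"
        using comp[of p q] pq by (auto simp: B_def)
      then have "compatible_in (h ` S) r' (h p) (h q)"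
        using that by (auto simp: compatible_in_def B_def r')
      moreover have "h p \<noteq> h q" using that inj_onD[OF h] by (auto simp: B_def)
      ultimately show False using anti that by (auto simp: B_def)
    qed
    moreover have "B \<subseteq> P" using S(2) by (auto simp: B_def)
    ultimately have "countable B" using ccc unfolding ccc_def by blast
    moreover have "A = h ` B" using A by (auto simp: B_def)
    ultimately show "countable A" by simp
  qed
  moreover have "|\<D>'| \<le>o cardSuc natLeq"
    unfolding \<D>'_def using card_of_image card by (rule ordLeq_transitive)
  moreover have "\<forall>D\<in>\<D>'. dense_in_poset (h ` S) r' D"
  proof
    fix D' assume "D' \<in> \<D>'"
    then obtain D where D: "D \<in> \<D>" "D' = h ` (D \<inter> S)" by (auto simp: \<D>'_def)
    have "\<exists>d\<in>D'. (d, h p) \<in> r'" if "p \<in> S" for p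
    proof
      have "F D p \<in> D" "(F D p, p) \<in> r" "F D p \<in> S" using F D FS S(2) that by auto
      then show "h (F D p) \<in> D'" "(h (F D p), h p) \<in> r'" using D that r' by auto
    qed
    then show "dense_in_poset (h ` S) r' D'" using D by (auto simp: dense_in_poset_def)
  qed
  ultimately obtain G' where G': "poset_filter (h ` S) r' G'" "\<forall>D\<in>\<D>'. G' \<inter> D \<noteq> {}"
    using MA unfolding MA_omega1_def by metis
  define G where "G = {p\<in>P. \<exists>s\<in>S. h s \<in> G' \<and> (s, p) \<in> r}"
  have GI: "s \<in> G" if "s \<in> S" "h s \<in> G'" for s
    using that S(2) refl by (auto simp: G_def)
  have "poset_filter P r G"
    unfolding poset_filter_def
  proof (intro conjI ballI impI)
    show "G \<noteq> {}" using G'(1) GI unfolding poset_filter_def by blast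
    show "G \<subseteq> P" by (auto simp: G_def)
    show "q \<in> G" if "p \<in> G" "q \<in> P" "(p, q) \<in> r" for p q
      using that trans unfolding G_def by blast
    show "\<exists>s\<in>G. (s, p) \<in> r \<and> (s, q) \<in> r" if pq: "p \<in> G" "q \<in> G" for p q
    proof -
      obtain a b where ab: "a \<in> S" "h a \<in> G'" "(a, p) \<in> r" "b \<in> S" "h b \<in> G'" "(b, q) \<in> r"
        using pq by (auto simp: G_def)
      then obtain x where x: "x \<in> G'" "(x, h a) \<in> r'" "(x, h b) \<in> r'"
        using G'(1) unfolding poset_filter_def by blast
      then obtain c where c: "c \<in> S" "x = h c"
        using G'(1) unfolding poset_filter_def by blast
      then have "(c, a) \<in> r" "(c, b) \<in> r" using x ab r' by auto
      then have "(c, p) \<in> r" "(c, q) \<in> r" using ab trans by blast+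
      moreover have "c \<in> G" using GI c x by blast
      ultimately show ?thesis by blast
    qed
  qed
  moreover have "\<forall>D\<in>\<D>. G \<inter> D \<noteq> {}"
  proof
    fix D assume "D \<in> \<D>"
    then have "G' \<inter> h ` (D \<inter> S) \<noteq> {}" using G'(2) by (auto simp: \<D>'_def)
    then show "G \<inter> D \<noteq> {}" using GI by auto
  qed
  ultimately show "\<exists>G. poset_filter P r G \<and> (\<forall>D\<in>\<D>. G \<inter> D \<noteq> {})" by blast
qed


section \<open>The \<open>c\<^sub>0\<close>-extension property\<close>

text \<open>The Banach space \<open>c\<^sub>0\<close> is realised inside \<^typ>\<open>nat \<Rightarrow>\<^sub>C real\<close>, which is \<open>\<ell>\<^sub>\<infinity>\<close> because
  \<^typ>\<open>nat\<close> carries the discrete topology. Likewise, for a type \<open>'k\<close> whose universe is compact,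
  \<open>'k \<Rightarrow>\<^sub>C real\<close> with its library norm is \<open>C(K)\<close>.\<close>

definition c0 :: "(nat \<Rightarrow>\<^sub>C real) set" where
  "c0 = {x. (\<lambda>n. apply_bcontfun x n) \<longlonglongrightarrow> 0}"

definition bounded_linear_on ::
    "'x::real_normed_vector set \<Rightarrow> ('x \<Rightarrow> 'y::real_normed_vector) \<Rightarrow> bool" where
  "bounded_linear_on Y T \<longleftrightarrow>
     (\<forall>x\<in>Y. \<forall>y\<in>Y. T (x + y) = T x + T y) \<and>
     (\<forall>a. \<forall>x\<in>Y. T (a *\<^sub>R x) = a *\<^sub>R T x) \<and>
     (\<exists>B. \<forall>x\<in>Y. norm (T x) \<le> B * norm x)"

definition c0_extension_property_in :: "'x::real_normed_vector set \<Rightarrow> bool" where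
  "c0_extension_property_in Y \<longleftrightarrow>
     subspace Y \<and> closed Y \<and>
     (\<forall>T :: 'x \<Rightarrow> (nat \<Rightarrow>\<^sub>C real). bounded_linear_on Y T \<and> T ` Y \<subseteq> c0 \<longrightarrow>
        (\<exists>S. bounded_linear S \<and> range S \<subseteq> c0 \<and> (\<forall>y\<in>Y. S y = T y)))"

text \<open>The value below is \<open>f \<circ> \<phi>\<close> only if \<open>\<phi>\<close> is continuous, since \<^const>\<open>Bcontfun\<close> is
  unspecified outside the bounded continuous functions.\<close>

definition composition_operator ::
    "('k::topological_space \<Rightarrow> 'l::topological_space) \<Rightarrow> ('l \<Rightarrow>\<^sub>C real) \<Rightarrow> ('k \<Rightarrow>\<^sub>C real)" where
  "composition_operator \<phi> f = Bcontfun (\<lambda>x. apply_bcontfun f (\<phi> x))"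

lemma apply_composition_operator:
  assumes "continuous_on UNIV \<phi>"
  shows "apply_bcontfun (composition_operator \<phi> f) x = apply_bcontfun f (\<phi> x)"
proof -
  have "continuous_on UNIV (\<lambda>x. apply_bcontfun f (\<phi> x))"
    using continuous_on_compose2[OF _ assms, of UNIV "apply_bcontfun f"] by simp
  moreover have "bounded (range (\<lambda>x. apply_bcontfun f (\<phi> x)))"
    using bounded_apply_bcontfun by (rule bounded_subset) auto
  ultimately show ?thesis
    unfolding composition_operator_def by (subst Bcontfun_inverse) (auto simp: bcontfun_def)
qed

text \<open>For a continuous surjection the conditions \<^const>\<open>subspace\<close> and \<^const>\<open>closed\<close> in
  \<^const>\<open>c0_extension_property_in\<close> hold automatically; see \<open>range_composition_operator\<close> below.\<close>

definition c0_extension_map :: "('k::topological_space \<Rightarrow> 'l::topological_space) \<Rightarrow> bool" where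
  "c0_extension_map \<phi> \<longleftrightarrow> c0_extension_property_in (range (composition_operator \<phi>))"

lemma Cauchy_bcontfun_convergent:
  fixes f :: "nat \<Rightarrow> ('a::topological_space \<Rightarrow>\<^sub>C 'b::complete_space)"
  assumes "Cauchy f"
  obtains l where "f \<longlonglongrightarrow> l"
proof -
  have "uniformly_Cauchy_on UNIV (\<lambda>n. apply_bcontfun (f n))"
    unfolding uniformly_Cauchy_on_def
    using assms dist_bounded[of "f _" _ "f _"] unfolding Cauchy_def by (meson le_less_trans)
  then obtain g where "uniform_limit UNIV (\<lambda>n. apply_bcontfun (f n)) g sequentially"
    using Cauchy_uniformly_convergent unfolding uniformly_convergent_on_def by blast
  from uniform_limit_bcontfunE[OF this sequentially_bot] show thesis
    using that by metis
qed

lemma range_composition_operator: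
  assumes "continuous_on UNIV \<phi>" and "surj \<phi>"
  shows "subspace (range (composition_operator \<phi>))" "closed (range (composition_operator \<phi>))"
proof -
  note app = apply_composition_operator[OF assms(1)]
  let ?c = "composition_operator \<phi>"
  have add: "?c (f + g) = ?c f + ?c g" and scale: "?c (a *\<^sub>R f) = a *\<^sub>R ?c f" for a f g
    by (auto intro!: bcontfun_eqI simp: app)
  then show "subspace (range ?c)"
    by (intro linear_subspace_image subspace_UNIV linearI)
  have isom: "dist (?c f) (?c g) = dist f g" for f g
  proof (rule antisym)
    show "dist (?c f) (?c g) \<le> dist f g"
      by (rule dist_bound) (simp add: app dist_bounded)
    show "dist f g \<le> dist (?c f) (?c g)"
    proof (rule dist_bound)
      fix t obtain x where "t = \<phi> x" using surjD[OF assms(2)] by blast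
      then show "dist (apply_bcontfun f t) (apply_bcontfun g t) \<le> dist (?c f) (?c g)"
        using dist_bounded[of "?c f" x "?c g"] by (simp add: app)
    qed
  qed
  have "complete (range ?c)"
    unfolding complete_def
  proof (intro allI impI; elim conjE)
    fix u assume u: "\<forall>n. u n \<in> range ?c" "Cauchy u"
    define v where "v n = inv ?c (u n)" for n
    have v: "u n = ?c (v n)" for n
      using u(1) by (simp add: v_def f_inv_into_f)
    have "Cauchy v" using u(2) unfolding Cauchy_def v isom .
    then obtain l where "v \<longlonglongrightarrow> l" by (rule Cauchy_bcontfun_convergent)
    then have "(\<lambda>n. dist (u n) (?c l)) \<longlonglongrightarrow> 0"
      using tendsto_dist_iff[of v l sequentially] unfolding v isom by blast
    then have "u \<longlonglongrightarrow> ?c l" by (rule iffD2[OF tendsto_dist_iff])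
    then show "\<exists>l\<in>range ?c. u \<longlonglongrightarrow> l" by blast
  qed
  then show "closed (range ?c)" by (rule complete_imp_closed)
qed


section \<open>Compact lines\<close>

definition internal_point :: "'l::linorder \<Rightarrow> bool" where
  "internal_point x \<longleftrightarrow>
     \<not> (\<forall>y. x \<le> y) \<and> \<not> (\<forall>y. y \<le> x) \<and>
     (\<forall>y. y > x \<longrightarrow> {x<..<y} \<noteq> {}) \<and> (\<forall>y. y < x \<longrightarrow> {y<..<x} \<noteq> {})"

definition multi_fibre_points :: "('k \<Rightarrow> 'l) \<Rightarrow> 'l set" where
  "multi_fibre_points \<phi> = {t. \<exists>x\<in>\<phi> -` {t}. \<exists>y\<in>\<phi> -` {t}. x \<noteq> y}"

definition countable_type :: "('k \<Rightarrow> 'l::linorder) \<Rightarrow> bool" where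
  "countable_type \<phi> \<longleftrightarrow> countable {t \<in> multi_fibre_points \<phi>. internal_point t}"

definition borel_regular :: "'l::linorder_topology itself \<Rightarrow> bool" where
  "borel_regular (_ :: 'l itself) \<longleftrightarrow> {x :: 'l. internal_point x} \<in> sets borel"

end

theory Submission
  imports Defs
begin

text \<open>Suppose that \<open>Q\<^sub>0(\<phi>)\<close> is uncountable. The aim is a weak*-null sequence of measures
  \<open>\<mu>\<^sub>n = \<delta>\<^bsub>q n\<^esub> - \<delta>\<^bsub>p n\<^esub>\<close> on \<open>L\<close> with \<open>p n \<le> q n\<close> such that uncountably many \<open>t \<in> Q\<^sub>0(\<phi>)\<close> lie in
  infinitely many of the intervals from \<open>p n\<close> to \<open>q n\<close>. The operator \<open>f \<circ> \<phi> \<mapsto> (\<mu>\<^sub>n f)\<close> then maps into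
  \<open>c\<^sub>0\<close>, and it has no extension to \<open>C(K)\<close>. For let \<open>\<Lambda>\<^sub>n\<close> be the coordinates of an extension. If the
  fibre of \<open>t\<close> has two points, \<open>C(K)\<close> contains a step \<open>f\<^sub>t\<close> that rises from \<open>0\<close> to \<open>1\<close> within the fibre.
  As \<open>\<Lambda>\<^sub>n\<close> is bounded, it can charge only countably many fibres, so for all but countably many \<open>t\<close>
  its value at \<open>f\<^sub>t\<close> is the one forced by \<open>\<mu>\<^sub>n\<close>, namely \<open>1\<close> if \<open>t\<close> is between \<open>p n\<close> and \<open>q n\<close> and \<open>0\<close>
  otherwise (\<open>finite_exceptional_points\<close>). Some \<open>t\<close> thus has \<open>\<Lambda>\<^sub>n f\<^sub>t = 1\<close> infinitely often, although
  \<open>\<Lambda>\<^sub>n f\<^sub>t\<close> must tend to \<open>0\<close>.\<close>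

text \<open>Such measures exist as soon as some compact set \<open>C\<close> of internal points has uncountable trace on
  \<open>Q\<^sub>0(\<phi>)\<close>: enumerate a countable dense set and let the \<open>n\<close>-th interval run through all the gaps
  that its finite initial parts leave and that meet \<open>C\<close>. Weak*-nullity could fail only
  if the gaps kept straddling a jump of \<open>L\<close>, and by compactness the absence of jumps at the points of \<open>C\<close>
  excludes that (\<open>null_difference_sequence\<close>).\<close>

text \<open>Martin's axiom and Borel regularity provide \<open>C\<close>. Any \<open>\<omega>\<^sub>1\<close> points of a Borel set are covered by
  countably many closed subsets of it (\<open>borel_fsigma_cover\<close>), so one of these contains uncountably many of
  the points. This uses only that \<open>\<omega>\<^sub>1\<close> functions on the natural numbers have a common eventual bound
  (\<open>MA_omega1_bounding\<close>), together with the fact that the open sets of a separable line are \<open>F\<^sub>\<sigma>\<close>.\<close>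

section \<open>Eventual domination under Martin's axiom\<close>

text \<open>Hechler's forcing for a function that dominates \<open>F\<close>: the first component of a condition is a finite
  initial segment of it, the second one holds promises that bind the values still to be chosen.\<close>
definition hechler_conditions :: "(nat \<Rightarrow> nat) set \<Rightarrow> (nat list \<times> (nat \<Rightarrow> nat) set) set" where
  "hechler_conditions F = {(s, H). finite H \<and> H \<subseteq> F}"

definition hechler_order :: "(nat \<Rightarrow> nat) set \<Rightarrow> (nat list \<times> (nat \<Rightarrow> nat) set) rel" where
  "hechler_order F = {((s', H'), (s, H)).
     (s', H') \<in> hechler_conditions F \<and> (s, H) \<in> hechler_conditions F \<and>
     take (length s) s' = s \<and> H \<subseteq> H' \<and>
     (\<forall>f\<in>H. \<forall>n. length s \<le> n \<and> n < length s' \<longrightarrow> f n \<le> s' ! n)}"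

lemma hechler_partial_order: "partial_order_on (hechler_conditions F) (hechler_order F)"
  unfolding partial_order_on_def preorder_on_def refl_on_def
proof (intro conjI)
  show "hechler_order F \<subseteq> hechler_conditions F \<times> hechler_conditions F"
    by (auto simp: hechler_order_def)
  show "\<forall>x\<in>hechler_conditions F. (x, x) \<in> hechler_order F"
    by (auto simp: hechler_order_def)
  show "Relation.trans (hechler_order F)"
  proof (rule transI)
    fix p q r assume pq: "(p, q) \<in> hechler_order F" and qr: "(q, r) \<in> hechler_order F"
    obtain s H t I u J where [simp]: "p = (s, H)" "q = (t, I)" "r = (u, J)"
      by (cases p; cases q; cases r)
    have len: "length t \<le> length s" "length u \<le> length t"
      using pq qr by (auto simp: hechler_order_def dest!: arg_cong[where f = length])
    have "take (length u) s = u"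
      using pq qr len by (auto simp: hechler_order_def) (metis min.absorb1 take_take)
    moreover have "f n \<le> s ! n" if "f \<in> J" "length u \<le> n" "n < length s" for f n
    proof (cases "n < length t")
      case True
      then have "s ! n = t ! n" using pq by (auto simp: hechler_order_def) (metis nth_take)
      then show ?thesis using qr that True by (auto simp: hechler_order_def)
    next
      case False
      then show ?thesis using pq qr that by (auto simp: hechler_order_def)
    qed
    ultimately show "(p, r) \<in> hechler_order F" using pq qr by (auto simp: hechler_order_def)
  qed
  show "Relation.antisym (hechler_order F)"
  proof (rule antisymI)
    fix p q assume pq: "(p, q) \<in> hechler_order F" and qp: "(q, p) \<in> hechler_order F"
    obtain s H t I where [simp]: "p = (s, H)" "q = (t, I)"
      by (cases p; cases q)
    have "take (length t) s = t" "take (length s) t = s" "H = I"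
      using pq qp by (auto simp: hechler_order_def)
    then have "s = t" by (metis nle_le take_all)
    with \<open>H = I\<close> show "p = q" by simp
  qed
qed

text \<open>Two conditions with the same initial segment are compatible: unite their promises. Since there
  are only countably many segments, an antichain is countable.\<close>
lemma hechler_ccc: "ccc (hechler_conditions F) (hechler_order F)"
  unfolding ccc_def
proof (intro allI impI; elim conjE)
  fix A assume sub: "A \<subseteq> hechler_conditions F"
    and anti: "\<forall>p\<in>A. \<forall>q\<in>A. p \<noteq> q \<longrightarrow>
      \<not> compatible_in (hechler_conditions F) (hechler_order F) p q"
  have "inj_on fst A"
  proof (rule inj_onI, rule ccontr)
    fix p q assume pq: "p \<in> A" "q \<in> A" "fst p = fst q" "p \<noteq> q"
    obtain s H I where eq: "p = (s, H)" "q = (s, I)"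
      using pq by (cases p; cases q) auto
    have "((s, H \<union> I), p) \<in> hechler_order F" "((s, H \<union> I), q) \<in> hechler_order F"
      "(s, H \<union> I) \<in> hechler_conditions F"
      using sub pq eq by (auto simp: hechler_order_def hechler_conditions_def)
    then show False using anti pq unfolding compatible_in_def by blast
  qed
  then show "countable A" by (metis countableI_type countable_image_inj_on)
qed

text \<open>A segment is prolonged by the pointwise maximum of the promised functions, which keeps
  every promise.\<close>
lemma hechler_dense_length:
  "dense_in_poset (hechler_conditions F) (hechler_order F)
     {(s, H) \<in> hechler_conditions F. n < length s}"
proof -
  have "\<exists>s' H'. (s', H') \<in> hechler_conditions F \<and> n < length s' \<and>
      ((s', H'), (s, H)) \<in> hechler_order F" if "(s, H) \<in> hechler_conditions F" for s H
  proof -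
    define m where "m k = Max (insert 0 ((\<lambda>f. f k) ` H))" for k :: nat
    define s' where "s' = s @ map m [length s..<length s + Suc n]"
    have "finite H" using that by (auto simp: hechler_conditions_def)
    then have m: "f k \<le> m k" if "f \<in> H" for f k
      using that unfolding m_def by (intro Max_ge) auto
    have "s' ! k = m k" if "length s \<le> k" "k < length s'" for k
      using that by (simp add: s'_def nth_append del: upt_Suc)
    then have "((s', H), (s, H)) \<in> hechler_order F"
      using that m by (auto simp: hechler_order_def hechler_conditions_def s'_def)
    moreover have "n < length s'" by (simp add: s'_def)
    ultimately show ?thesis using that by (auto simp: hechler_conditions_def)
  qed
  then show ?thesis unfolding dense_in_poset_def by fastforce
qed

lemma hechler_dense_member:
  assumes "f \<in> F"
  shows "dense_in_poset (hechler_conditions F) (hechler_order F)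
     {(s, H) \<in> hechler_conditions F. f \<in> H}"
proof -
  have "((s, insert f H), (s, H)) \<in> hechler_order F"
    "(s, insert f H) \<in> hechler_conditions F" if "(s, H) \<in> hechler_conditions F" for s H
    using that assms by (auto simp: hechler_order_def hechler_conditions_def)
  then show ?thesis unfolding dense_in_poset_def by fastforce
qed

lemma countable_iff_ordLeq_natLeq: "countable A \<longleftrightarrow> |A| \<le>o natLeq"
proof -
  have "countable A \<longleftrightarrow> |A| \<le>o |UNIV :: nat set|"
    unfolding countable_def card_of_ordLeq[symmetric] by auto
  then show ?thesis
    using card_of_nat ordIso_symmetric ordLeq_ordIso_trans by blast
qed

text \<open>The cardinal \<open>\<bb>\<close> exceeds \<open>\<omega>\<^sub>1\<close>: the union of the segments in a sufficiently generic filter is a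
  function that eventually dominates each given one. Eventual domination is expressed by an additive
  constant, which absorbs the finitely many exceptional arguments.\<close>
lemma MA_omega1_bounding:
  fixes F :: "(nat \<Rightarrow> nat) set"
  assumes MA: "MA_omega1 TYPE(nat set)" and F: "|F| \<le>o cardSuc natLeq"
  shows "\<exists>g. \<forall>f\<in>F. \<exists>k. \<forall>n. f n \<le> g n + k"
proof -
  let ?P = "hechler_conditions F" and ?r = "hechler_order F"
  let ?long = "\<lambda>n. {(s, H) \<in> ?P. n < length s}" and ?mem = "\<lambda>f. {(s, H) \<in> ?P. f \<in> H}"
  have inf: "\<not> finite (Field (cardSuc natLeq))"
    using Cinfinite_cardSuc[OF natLeq_Cinfinite] by (simp add: cinfinite_def)
  define \<D> where "\<D> = range ?long \<union> ?mem ` F"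
  have "|\<D>| \<le>o cardSuc natLeq"
    unfolding \<D>_def
  proof (rule card_of_Un_ordLeq_infinite_Field[OF inf])
    have "|range ?long| \<le>o natLeq" by (simp add: countable_iff_ordLeq_natLeq[symmetric])
    then show "|range ?long| \<le>o cardSuc natLeq"
      using cardSuc_ordLeq[OF natLeq_Card_order] by (rule ordLeq_transitive)
    show "|?mem ` F| \<le>o cardSuc natLeq" using card_of_image F by (rule ordLeq_transitive)
  qed (simp add: cardSuc_Card_order natLeq_Card_order)
  moreover have "\<forall>D\<in>\<D>. dense_in_poset ?P ?r D"
    unfolding \<D>_def using hechler_dense_length hechler_dense_member by blast
  moreover have "?P \<noteq> {}" by (auto simp: hechler_conditions_def)
  ultimately have "\<exists>G. poset_filter ?P ?r G \<and> (\<forall>D\<in>\<D>. G \<inter> D \<noteq> {})"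
    using MA_omega1_nat_set[OF MA, unfolded MA_omega1_def, rule_format, of ?P ?r \<D>]
      hechler_partial_order hechler_ccc by blast
  then obtain G where G: "poset_filter ?P ?r G" and meet: "\<And>D. D \<in> \<D> \<Longrightarrow> G \<inter> D \<noteq> {}"
    by blast
  have "\<exists>s H. (s, H) \<in> G \<and> n < length s" for n
  proof -
    have "?long n \<in> \<D>" unfolding \<D>_def by (intro UnI1 rangeI)
    from meet[OF this] show ?thesis by auto
  qed
  then have "\<exists>p. p \<in> G \<and> n < length (fst p)" for n by fastforce
  then obtain p where p: "\<And>n. p n \<in> G \<and> n < length (fst (p n))" by metis
  define s H where "s n = fst (p n)" and "H n = snd (p n)" for n
  have s: "(s n, H n) \<in> G" "n < length (s n)" for n using p by (auto simp: s_def H_def)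
  define g where "g n = s n ! n" for n
  have "\<exists>k. \<forall>n. f n \<le> g n + k" if "f \<in> F" for f
  proof -
    have "?mem f \<in> \<D>" unfolding \<D>_def using that by (intro UnI2 imageI)
    from meet[OF this] obtain t I where t: "(t, I) \<in> G" "f \<in> I" by auto
    have tail: "f n \<le> g n" if "length t \<le> n" for n
    proof -
      obtain u J where u: "((u, J), (t, I)) \<in> ?r" "((u, J), (s n, H n)) \<in> ?r"
      proof -
        have "\<forall>p\<in>G. \<forall>q\<in>G. \<exists>r\<in>G. (r, p) \<in> ?r \<and> (r, q) \<in> ?r"
          using G by (simp add: poset_filter_def)
        then obtain r where "(r, (t, I)) \<in> ?r" "(r, (s n, H n)) \<in> ?r"
          using t(1) s(1)[of n] by blast
        then show thesis using that by (cases r) auto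
      qed
      then have take: "take (length (s n)) u = s n" by (auto simp: hechler_order_def)
      then have "length (s n) \<le> length u" by (metis length_take min.cobounded1 min_def)
      then have "n < length u" using s(2)[of n] by simp
      then have "f n \<le> u ! n" using u(1) t(2) that by (auto simp: hechler_order_def)
      also have "u ! n = g n" using take s(2)[of n] unfolding g_def by (metis nth_take)
      finally show ?thesis .
    qed
    have "f n \<le> g n + Max (insert 0 (f ` {..<length t}))" for n
    proof (cases "n < length t")
      case True
      then have "f n \<le> Max (insert 0 (f ` {..<length t}))" by (intro Max_ge) auto
      then show ?thesis by simp
    qed (use tail in \<open>simp add: trans_le_add1\<close>)
    then show ?thesis by blast
  qed
  then show ?thesis by blast
qed

section \<open>Open sets of separable lines\<close>

lemma separable_dense_set:
  assumes "separable_space (euclidean :: 'l::topological_space topology)"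
  obtains D :: "'l::topological_space set" where "countable D" "\<And>U. open U \<Longrightarrow> U \<noteq> {} \<Longrightarrow> D \<inter> U \<noteq> {}"
proof -
  obtain D :: "'l set" where D: "countable D" "closure D = UNIV"
    using assms by (auto simp: separable_space_def)
  have "D \<inter> U \<noteq> {}" if "open U" "U \<noteq> {}" for U
    using open_Int_closure_eq_empty[OF that(1), of D] that(2) D(2) by auto
  with D(1) show thesis by (rule that)
qed

text \<open>The points that can be reached from \<open>d\<close> inside \<open>U\<close> by going up. If there is a last one, they
  form a closed interval; otherwise any reachable point has two further ones above it, hence an
  element of \<open>D\<close> between it and the second of them, so the reachable elements of \<open>D\<close> are cofinal.\<close>
lemma fsigma_reach_up:
  fixes U :: "'l::linorder_topology set"
  assumes D: "countable D" "\<And>V :: 'l set. open V \<Longrightarrow> V \<noteq> {} \<Longrightarrow> D \<inter> V \<noteq> {}"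
  shows "fsigma_in euclidean {x. d \<le> x \<and> {d..x} \<subseteq> U}"
proof -
  let ?R = "{x. d \<le> x \<and> {d..x} \<subseteq> U}"
  show ?thesis
  proof (cases "\<exists>m\<in>?R. \<forall>x\<in>?R. x \<le> m")
    case True
    then obtain m where m: "m \<in> ?R" "\<forall>x\<in>?R. x \<le> m" by blast
    have "?R = {d..m}" using m by fastforce
    then show ?thesis by (metis closed_atLeastAtMost closed_closedin closed_imp_fsigma_in)
  next
    case False
    have "?R = (\<Union>e\<in>D \<inter> ?R. {d..e})"
    proof (intro equalityI subsetI)
      fix x assume x: "x \<in> ?R"
      obtain y where y: "y \<in> ?R" "x < y" using False x by (meson not_le)
      obtain z where z: "z \<in> ?R" "y < z" using False y by (meson not_le)
      have "y \<in> {x<..<z}" using y z by simp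
      then obtain e where e: "e \<in> D" "x < e" "e < z"
        using D(2)[of "{x<..<z}"] by fastforce
      then have "e \<in> ?R" using x z by fastforce
      then have "e \<in> D \<inter> ?R" "x \<in> {d..e}" using e x by auto
      then show "x \<in> (\<Union>e\<in>D \<inter> ?R. {d..e})" by blast
    next
      fix x assume "x \<in> (\<Union>e\<in>D \<inter> ?R. {d..e})"
      then obtain e where "e \<in> ?R" "x \<in> {d..e}" by blast
      then have "d \<le> x" "{d..x} \<subseteq> {d..e}" "{d..e} \<subseteq> U" by auto
      then show "x \<in> ?R" by blast
    qed
    moreover have "fsigma_in euclidean (\<Union>e\<in>D \<inter> ?R. {d..e})"
      using D(1) by (intro fsigma_in_Union) (auto intro!: closed_imp_fsigma_in)
    ultimately show ?thesis by simp
  qed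
qed

lemma fsigma_reach_down:
  fixes U :: "'l::linorder_topology set"
  assumes D: "countable D" "\<And>V :: 'l set. open V \<Longrightarrow> V \<noteq> {} \<Longrightarrow> D \<inter> V \<noteq> {}"
  shows "fsigma_in euclidean {x. x \<le> d \<and> {x..d} \<subseteq> U}"
proof -
  let ?R = "{x. x \<le> d \<and> {x..d} \<subseteq> U}"
  show ?thesis
  proof (cases "\<exists>m\<in>?R. \<forall>x\<in>?R. m \<le> x")
    case True
    then obtain m where m: "m \<in> ?R" "\<forall>x\<in>?R. m \<le> x" by blast
    have "?R = {m..d}" using m by fastforce
    then show ?thesis by (metis closed_atLeastAtMost closed_closedin closed_imp_fsigma_in)
  next
    case False
    have "?R = (\<Union>e\<in>D \<inter> ?R. {e..d})"
    proof (intro equalityI subsetI)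
      fix x assume x: "x \<in> ?R"
      obtain y where y: "y \<in> ?R" "y < x" using False x by (meson not_le)
      obtain z where z: "z \<in> ?R" "z < y" using False y by (meson not_le)
      have "y \<in> {z<..<x}" using y z by simp
      then obtain e where e: "e \<in> D" "z < e" "e < x"
        using D(2)[of "{z<..<x}"] by fastforce
      then have "e \<in> ?R" using x z by fastforce
      then have "e \<in> D \<inter> ?R" "x \<in> {e..d}" using e x by auto
      then show "x \<in> (\<Union>e\<in>D \<inter> ?R. {e..d})" by blast
    next
      fix x assume "x \<in> (\<Union>e\<in>D \<inter> ?R. {e..d})"
      then obtain e where "e \<in> ?R" "x \<in> {e..d}" by blast
      then have "x \<le> d" "{x..d} \<subseteq> {e..d}" "{e..d} \<subseteq> U" by auto
      then show "x \<in> ?R" by blast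
    qed
    moreover have "fsigma_in euclidean (\<Union>e\<in>D \<inter> ?R. {e..d})"
      using D(1) by (intro fsigma_in_Union) (auto intro!: closed_imp_fsigma_in)
    ultimately show ?thesis by simp
  qed
qed

text \<open>A separable line, such as the double arrow space, need not be metrizable or second countable,
  so this is not a matter of countable bases. Rather, every point of \<open>U\<close> lies in the same convex
  component of \<open>U\<close> as some element of \<open>D\<close>, and a component is a union of two reachable sets.\<close>
lemma open_fsigma_separable_line:
  fixes U :: "'l::linorder_topology set"
  assumes sep: "separable_space (euclidean :: 'l topology)" and U: "open U"
  shows "fsigma_in euclidean U"
proof -
  obtain D :: "'l set" where D: "countable D" "\<And>V. open V \<Longrightarrow> V \<noteq> {} \<Longrightarrow> D \<inter> V \<noteq> {}"
    using separable_dense_set[OF sep] by blast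
  let ?up = "\<lambda>d. {x. d \<le> x \<and> {d..x} \<subseteq> U}" and ?down = "\<lambda>d. {x. x \<le> d \<and> {x..d} \<subseteq> U}"
  have "\<exists>d\<in>D. x \<in> ?up d \<union> ?down d" if x: "x \<in> U" for x
  proof -
    obtain A where A: "open A" "x \<in> A" "\<And>y z. y \<in> A \<Longrightarrow> y \<le> z \<Longrightarrow> z \<le> x \<Longrightarrow> z \<in> U"
    proof (cases "\<exists>y. y < x")
      case True
      then obtain b where "b < x" "{b<..x} \<subseteq> U" using open_left[OF U x] by blast
      then show thesis by (intro that[of "{b<..}"]) (auto simp: subset_iff)
    next
      case False
      then show thesis using x by (intro that[of UNIV]) (auto simp: not_less dest: order.antisym)
    qed
    obtain B where B: "open B" "x \<in> B" "\<And>y z. y \<in> B \<Longrightarrow> x \<le> z \<Longrightarrow> z \<le> y \<Longrightarrow> z \<in> U"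
    proof (cases "\<exists>y. x < y")
      case True
      then obtain b where "x < b" "{x..<b} \<subseteq> U" using open_right[OF U x] by blast
      then show thesis by (intro that[of "{..<b}"]) (auto simp: subset_iff)
    next
      case False
      then show thesis using x by (intro that[of UNIV]) (auto simp: not_less dest: order.antisym)
    qed
    obtain d where "d \<in> D" "d \<in> A" "d \<in> B" using D(2)[of "A \<inter> B"] A B by blast
    moreover from this have "x \<in> ?up d \<union> ?down d"
      using A(3) B(3) by (cases "d \<le> x") auto
    ultimately show ?thesis by blast
  qed
  then have "U = (\<Union>d\<in>D. ?up d \<union> ?down d)" by fastforce
  moreover have "fsigma_in euclidean (\<Union>d\<in>D. ?up d \<union> ?down d)"
    using D by (intro fsigma_in_Union) (auto intro!: fsigma_in_Un fsigma_reach_up fsigma_reach_down)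
  ultimately show ?thesis by simp
qed

section \<open>Closed sets inside Borel sets\<close>

text \<open>An intersection of countably many \<open>F\<^sub>\<sigma>\<close> sets need not be \<open>F\<^sub>\<sigma>\<close>, but it contains one that
  swallows any prescribed \<open>\<omega>\<^sub>1\<close> of its points. Writing \<open>A n\<close> as an increasing union of closed sets
  \<open>C n i\<close>, a point of the intersection is described by the function that sends \<open>n\<close> to its rank in this
  union, and a single \<open>g\<close> dominates all \<open>\<omega>\<^sub>1\<close> rank functions up to an additive constant \<open>k\<close>. The
  sets \<open>\<Inter>n. C n (g n + k)\<close> are closed, and there are countably many of them.\<close>
lemma fsigma_cover_INT:
  fixes A :: "nat \<Rightarrow> 'a set"
  assumes MA: "MA_omega1 TYPE(nat set)" and E: "|E| \<le>o cardSuc natLeq"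
    and A: "\<And>n. fsigma_in X (A n)"
  shows "\<exists>A'. fsigma_in X A' \<and> A' \<subseteq> (\<Inter>n. A n) \<and> E \<inter> (\<Inter>n. A n) \<subseteq> A'"
proof -
  have "\<exists>C. (\<forall>i. closedin X (C i)) \<and> (\<forall>i. C i \<subseteq> C (Suc i)) \<and> (\<Union>i. C i) = A n" for n :: nat
    using A[of n] by (rule fsigma_in_ascending[THEN iffD1])
  then have "\<forall>n. \<exists>C. (\<forall>i. closedin X (C i)) \<and> (\<forall>i. C i \<subseteq> C (Suc i)) \<and> (\<Union>i. C i) = A n"
    by (rule allI)
  from choice[OF this] obtain C where "\<forall>n. (\<forall>i. closedin X (C n i)) \<and>
    (\<forall>i. C n i \<subseteq> C n (Suc i)) \<and> (\<Union>i. C n i) = A n" ..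
  then have C: "closedin X (C n i)" "C n i \<subseteq> C n (Suc i)" "(\<Union>i. C n i) = A n" for n i
    by simp_all
  have mono: "C n i \<subseteq> C n j" if "i \<le> j" for n i j :: nat
    using C(2) that by (rule lift_Suc_mono_le)
  define rank where "rank e n = (LEAST i. e \<in> C n i)" for e n
  have rank: "e \<in> C n (rank e n)" if "e \<in> (\<Inter>n. A n)" for e n
  proof -
    have "e \<in> (\<Union>i. C n i)" using that by (simp add: C(3))
    then obtain i where "e \<in> C n i" by blast
    then show ?thesis unfolding rank_def by (rule LeastI)
  qed
  have "|rank ` E| \<le>o cardSuc natLeq" using card_of_image E by (rule ordLeq_transitive)
  from MA_omega1_bounding[OF MA this]
  obtain g where g: "\<forall>f\<in>rank ` E. \<exists>k. \<forall>n. f n \<le> g n + k" ..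
  define A' where "A' = (\<Union>k. \<Inter>n. C n (g n + k))"
  have "fsigma_in X (\<Inter>n. C n (g n + k))" for k
    using C(1) by (intro closed_imp_fsigma_in closedin_Inter) auto
  then have "fsigma_in X A'"
    unfolding A'_def by (intro fsigma_in_Union) auto
  moreover have "A' \<subseteq> (\<Inter>n. A n)" unfolding A'_def using C(3) by blast
  moreover have "E \<inter> (\<Inter>n. A n) \<subseteq> A'"
  proof
    fix e assume e: "e \<in> E \<inter> (\<Inter>n. A n)"
    then have "\<exists>k. \<forall>n. rank e n \<le> g n + k" using g by simp
    then obtain k where k: "\<forall>n. rank e n \<le> g n + k" ..
    have "e \<in> C n (g n + k)" for n
    proof -
      have "C n (rank e n) \<subseteq> C n (g n + k)" using k by (intro mono) simp
      moreover have "e \<in> C n (rank e n)" using e by (intro rank) simp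
      ultimately show ?thesis ..
    qed
    then have "e \<in> (\<Inter>n. C n (g n + k))" by (rule INT_I)
    then show "e \<in> A'" unfolding A'_def by (rule UN_I[OF UNIV_I])
  qed
  ultimately show ?thesis by (intro exI conjI)
qed

text \<open>Induction over the \<open>\<sigma>\<close>-algebra, carried out for a set and its complement at once so that
  complements are harmless; the only substantial step is the countable intersection.\<close>
lemma borel_fsigma_cover:
  fixes E B :: "'l::topological_space set"
  assumes MA: "MA_omega1 TYPE(nat set)" and E: "|E| \<le>o cardSuc natLeq"
    and op: "\<And>U :: 'l set. open U \<Longrightarrow> fsigma_in euclidean U"
    and B: "B \<in> sets borel"
  shows "\<exists>A. fsigma_in euclidean A \<and> A \<subseteq> B \<and> E \<inter> B \<subseteq> A"
proof -
  let ?cov = "\<lambda>B. \<exists>A. fsigma_in euclidean A \<and> A \<subseteq> B \<and> E \<inter> B \<subseteq> A"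
  have Un: "?cov (\<Union>n. a n)" if a: "\<And>n. ?cov (a n)" for a :: "nat \<Rightarrow> 'l set"
  proof -
    from a have "\<forall>n. ?cov (a n)" by (rule allI)
    from choice[OF this] obtain A
      where "\<forall>n. fsigma_in euclidean (A n) \<and> A n \<subseteq> a n \<and> E \<inter> a n \<subseteq> A n" ..
    then have A: "fsigma_in euclidean (A n)" "A n \<subseteq> a n" "E \<inter> a n \<subseteq> A n" for n
      by simp_all
    have "fsigma_in euclidean (\<Union>n. A n)" using A(1) by (intro fsigma_in_Union) auto
    moreover have "(\<Union>n. A n) \<subseteq> (\<Union>n. a n)" using A(2) by (rule UN_mono[OF subset_refl])
    moreover have "E \<inter> (\<Union>n. a n) \<subseteq> (\<Union>n. A n)" using A(3) by fast
    ultimately show ?thesis by (intro exI conjI)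
  qed
  have Int: "?cov (\<Inter>n. a n)" if a: "\<And>n. ?cov (a n)" for a :: "nat \<Rightarrow> 'l set"
  proof -
    from a have "\<forall>n. ?cov (a n)" by (rule allI)
    from choice[OF this] obtain A
      where "\<forall>n. fsigma_in euclidean (A n) \<and> A n \<subseteq> a n \<and> E \<inter> a n \<subseteq> A n" ..
    then have A: "fsigma_in euclidean (A n)" "A n \<subseteq> a n" "E \<inter> a n \<subseteq> A n" for n
      by simp_all
    from fsigma_cover_INT[where A = A, OF MA E A(1)]
    obtain A' where A': "fsigma_in euclidean A'" "A' \<subseteq> (\<Inter>n. A n)" "E \<inter> (\<Inter>n. A n) \<subseteq> A'"
      by (elim exE conjE)
    have "A' \<subseteq> (\<Inter>n. a n)" using A'(2) A(2) by fast
    moreover have "E \<inter> (\<Inter>n. a n) \<subseteq> A'" using A'(3) A(3) by fast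
    ultimately show ?thesis using A'(1) by (intro exI conjI)
  qed
  have "B \<in> sigma_sets UNIV {U. open U}" using B by (simp add: borel_def)
  then have "?cov B \<and> ?cov (- B)"
  proof (induction rule: sigma_sets.induct)
    case (Basic U)
    then have "closedin euclidean (- U)" by auto
    with Basic op show ?case using closed_imp_fsigma_in by blast
  next
    case Empty
    show ?case using fsigma_in_empty fsigma_in_topspace[of euclidean] by auto
  next
    case (Compl a)
    then show ?case by (simp add: Compl_eq_Diff_UNIV[symmetric])
  next
    case (Union a)
    have "- (\<Union>n. a n) = (\<Inter>n. - a n)" by blast
    then show ?case using Un[of a] Int[of "\<lambda>n. - a n"] Union by simp
  qed
  then show ?thesis ..
qed

lemma uncountable_subset_omega1:
  assumes "uncountable Q"
  obtains E where "E \<subseteq> Q" "uncountable E" "|E| \<le>o cardSuc natLeq"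
proof -
  let ?O = "cardSuc natLeq"
  have CO: "Card_order ?O" by (simp add: cardSuc_Card_order natLeq_Card_order)
  have "natLeq <o |Q|"
    using assms not_ordLeq_iff_ordLess[OF natLeq_Well_order card_of_Well_order, of Q]
    unfolding countable_iff_ordLeq_natLeq by blast
  then have "?O \<le>o |Q|"
    by (rule cardSuc_least[OF natLeq_Card_order card_of_Card_order])
  moreover have F: "|Field ?O| =o ?O" using card_of_Field_ordIso[OF CO] .
  ultimately have "|Field ?O| \<le>o |Q|" using ordIso_ordLeq_trans by blast
  then obtain f where f: "inj_on f (Field ?O)" "f ` Field ?O \<subseteq> Q"
    unfolding card_of_ordLeq[symmetric] by blast
  have iso: "|Field ?O| =o |f ` Field ?O|"
    using inj_on_imp_bij_betw[OF f(1)] unfolding card_of_ordIso[symmetric] by blast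
  have card: "|f ` Field ?O| =o ?O"
    using ordIso_transitive[OF ordIso_symmetric[OF iso] F] .
  have "uncountable (f ` Field ?O)"
  proof
    assume "countable (f ` Field ?O)"
    then have "?O \<le>o natLeq"
      unfolding countable_iff_ordLeq_natLeq using ordIso_symmetric[OF card]
      by (rule ordIso_ordLeq_trans[rotated])
    with cardSuc_greater[OF natLeq_Card_order] show False
      using not_ordLess_ordLeq by blast
  qed
  with f(2) ordIso_imp_ordLeq[OF card] show thesis by (intro that)
qed

lemma closed_uncountable_trace:
  fixes B Q :: "'l::topological_space set"
  assumes MA: "MA_omega1 TYPE(nat set)"
    and op: "\<And>U :: 'l set. open U \<Longrightarrow> fsigma_in euclidean U"
    and B: "B \<in> sets borel" and Q: "Q \<subseteq> B" "uncountable Q"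
  obtains C where "closed C" "C \<subseteq> B" "uncountable (C \<inter> Q)"
proof -
  obtain E where E: "E \<subseteq> Q" "uncountable E" "|E| \<le>o cardSuc natLeq"
    using uncountable_subset_omega1[OF Q(2)] .
  obtain A where A: "fsigma_in euclidean A" "A \<subseteq> B" "E \<inter> B \<subseteq> A"
    using borel_fsigma_cover[OF MA E(3) op B] by blast
  obtain C :: "nat \<Rightarrow> 'l set" where C: "\<And>n. closed (C n)" "(\<Union>n. C n) = A"
    using A(1) unfolding fsigma_in_ascending by auto
  have "E \<subseteq> (\<Union>n. C n \<inter> Q)" using E(1) Q(1) A(3) C(2) by blast
  then have "\<not> (\<forall>n. countable (C n \<inter> Q))"
    using E(2) countable_subset[of E] by (metis countable_UN countableI_type)
  then obtain n where "uncountable (C n \<inter> Q)" by blast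
  with C A(2) show thesis by (intro that[of "C n"]) auto
qed

section \<open>Gaps between the terms of a dense sequence\<close>

text \<open>The stage \<open>m\<close> is a parameter of its own, so that an interval counts again at each stage until a new
  term of \<open>d\<close> splits it. There are finitely many gaps at each stage.\<close>
definition gap :: "(nat \<Rightarrow> 'l::linorder) \<Rightarrow> 'l set \<Rightarrow> nat \<Rightarrow> nat \<Rightarrow> nat \<Rightarrow> bool" where
  "gap d C m i j \<longleftrightarrow> i < m \<and> j < m \<and> d i < d j \<and>
     (\<forall>k<m. d k \<le> d i \<or> d j \<le> d k) \<and> (\<exists>c\<in>C. d i < c \<and> c < d j)"

text \<open>Around an internal point \<open>c\<close> there are members \<open>d i < c < d j\<close> of the dense sequence between
  which \<open>f\<close> is nearly constant; a jump of the line next to \<open>c\<close> would prevent this. Finitely many of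
  these intervals cover \<open>C\<close>, and once their endpoints are among the first \<open>m\<close> terms, each gap that
  meets \<open>C\<close> is contained in one of them.\<close>
lemma gap_oscillation:
  fixes f :: "'l::linorder_topology \<Rightarrow> real"
  assumes C: "compact C" "\<And>c. c \<in> C \<Longrightarrow> internal_point c"
    and d: "\<And>U :: 'l set. open U \<Longrightarrow> U \<noteq> {} \<Longrightarrow> range d \<inter> U \<noteq> {}"
    and f: "continuous_on UNIV f" and "\<epsilon> > 0"
  obtains M where "\<And>m i j. m \<ge> M \<Longrightarrow> gap d C m i j \<Longrightarrow> \<bar>f (d j) - f (d i)\<bar> < \<epsilon>"
proof -
  have "\<exists>i j. d i < c \<and> c < d j \<and> (\<forall>x\<in>{d i..d j}. \<bar>f x - f c\<bar> < \<epsilon> / 2)" if "c \<in> C" for c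
  proof -
    define U where "U = {x. \<bar>f x - f c\<bar> < \<epsilon> / 2}"
    have "open U" unfolding U_def
      by (intro open_Collect_less continuous_intros f)
    have "c \<in> U" using \<open>\<epsilon> > 0\<close> by (simp add: U_def)
    note int = C(2)[OF that, unfolded internal_point_def]
    obtain y z where "y < c" "c < z" using int by (auto simp: not_le)
    obtain a where a: "a < c" "{a<..c} \<subseteq> U"
      using open_left[OF \<open>open U\<close> \<open>c \<in> U\<close> \<open>y < c\<close>] by blast
    obtain b where b: "c < b" "{c..<b} \<subseteq> U"
      using open_right[OF \<open>open U\<close> \<open>c \<in> U\<close> \<open>c < z\<close>] by blast
    obtain i where i: "a < d i" "d i < c" using d[of "{a<..<c}"] int a(1) by auto
    obtain j where j: "c < d j" "d j < b" using d[of "{c<..<b}"] int b(1) by auto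
    have "x \<in> {a<..c} \<union> {c..<b}" if "x \<in> {d i..d j}" for x
      using that i j by auto
    then have "x \<in> U" if "x \<in> {d i..d j}" for x using that a(2) b(2) by blast
    with i j show ?thesis unfolding U_def by blast
  qed
  then obtain I J where IJ: "\<And>c. c \<in> C \<Longrightarrow> d (I c) < c \<and> c < d (J c)"
    "\<And>c x. c \<in> C \<Longrightarrow> x \<in> {d (I c)..d (J c)} \<Longrightarrow> \<bar>f x - f c\<bar> < \<epsilon> / 2"
    by metis
  obtain C' where C': "C' \<subseteq> C" "finite C'" "C \<subseteq> (\<Union>c\<in>C'. {d (I c)<..<d (J c)})"
    using compactE_image[OF C(1), of C "\<lambda>c. {d (I c)<..<d (J c)}"] IJ(1) by force
  show thesis
  proof (rule that[of "Suc (\<Sum>c\<in>C'. I c + J c)"])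
    fix m i j assume m: "Suc (\<Sum>c\<in>C'. I c + J c) \<le> m" and g: "gap d C m i j"
    obtain x where x: "x \<in> C" "d i < x" "x < d j" using g by (auto simp: gap_def)
    obtain c where c: "c \<in> C'" "d (I c) < x" "x < d (J c)" using x(1) C'(3) by auto
    have "I c + J c \<le> (\<Sum>c\<in>C'. I c + J c)" using c(1) C'(2) by (intro member_le_sum) auto
    then have "I c < m" "J c < m" using m by auto
    then have "d (I c) \<le> d i" "d j \<le> d (J c)"
      using g c x unfolding gap_def by (metis less_le_trans less_trans not_less)+
    then have "d i \<in> {d (I c)..d (J c)}" "d j \<in> {d (I c)..d (J c)}" using x c by auto
    then have "\<bar>f (d i) - f c\<bar> < \<epsilon> / 2" "\<bar>f (d j) - f c\<bar> < \<epsilon> / 2"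
      using IJ(2) c(1) C'(1) by blast+
    then show "\<bar>f (d j) - f (d i)\<bar> < \<epsilon>" by linarith
  qed
qed

lemma gap_around_point:
  fixes t :: "'l::linorder_topology"
  assumes t: "t \<in> C" "internal_point t" "t \<notin> range d"
    and d: "\<And>U :: 'l set. open U \<Longrightarrow> U \<noteq> {} \<Longrightarrow> range d \<inter> U \<noteq> {}"
  obtains M where "\<And>m. m \<ge> M \<Longrightarrow> \<exists>i j. gap d C m i j \<and> d i < t \<and> t < d j"
proof -
  obtain y z where "y < t" "t < z" using t(2) by (auto simp: internal_point_def not_le)
  then obtain i0 j0 where ij0: "d i0 < t" "t < d j0"
    using d[of "{..<t}"] d[of "{t<..}"] by auto
  show thesis
  proof (rule that[of "Suc (i0 + j0)"])
    fix m assume m: "Suc (i0 + j0) \<le> m"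
    let ?A = "d ` {k. k < m \<and> d k < t}" and ?B = "d ` {k. k < m \<and> t < d k}"
    have "i0 < m" "j0 < m" using m by auto
    with ij0 have ne: "?A \<noteq> {}" "?B \<noteq> {}" by blast+
    have "Max ?A \<in> ?A" using ne by (intro Max_in) auto
    then obtain i where i: "i < m" "d i < t" "d i = Max ?A" by auto
    have "Min ?B \<in> ?B" using ne by (intro Min_in) auto
    then obtain j where j: "j < m" "t < d j" "d j = Min ?B" by auto
    have "d k \<le> d i \<or> d j \<le> d k" if "k < m" for k
    proof (cases "d k < t")
      case True
      then show ?thesis unfolding i(3) using that by (intro disjI1 Max_ge) auto
    next
      case False
      then have "t < d k" using t(3) by (metis linorder_neqE rangeI)
      then show ?thesis unfolding j(3) using that by (intro disjI2 Min_le) auto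
    qed
    then have "gap d C m i j" unfolding gap_def using i j t(1) by auto
    with i j show "\<exists>i j. gap d C m i j \<and> d i < t \<and> t < d j" by blast
  qed
qed

section \<open>Functionals on steps\<close>

lemma compact_line_Urysohn:
  fixes u v :: "'a::linorder_topology"
  assumes "compact (UNIV :: 'a set)" and "u < v"
  obtains f :: "'a \<Rightarrow>\<^sub>C real" where "\<And>x. 0 \<le> f x" "\<And>x. f x \<le> 1"
    "\<And>x. x \<le> u \<Longrightarrow> f x = 0" "\<And>x. v \<le> x \<Longrightarrow> f x = 1"
proof -
  have "compact_space (euclidean :: 'a topology)" using assms(1) by (simp add: compact_space_def)
  moreover have "Hausdorff_space (euclidean :: 'a topology)"
    unfolding Hausdorff_space_def disjnt_def by (simp, metis hausdorff)
  ultimately have "normal_space (euclidean :: 'a topology)"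
    by (intro compact_Hausdorff_or_regular_imp_normal_space) auto
  moreover have "disjnt {..u} {v..}" using assms(2) by (auto simp: disjnt_def)
  ultimately obtain h :: "'a \<Rightarrow> real" where h: "continuous_map euclidean (top_of_set {0..1}) h"
    "h ` {..u} \<subseteq> {0}" "h ` {v..} \<subseteq> {1}"
    using Urysohn_lemma[of "euclidean :: 'a topology" "{..u}" "{v..}" 0 1]
    by (metis closed_atLeast closed_atMost closed_closedin zero_le_one)
  have cont: "continuous_on UNIV h" and range: "h x \<in> {0..1}" for x
    using h(1) by (auto simp: continuous_map_in_subtopology)
  have "bounded (range h)"
    by (rule bounded_subset[OF bounded_closed_interval[of 0 1]]) (use range in auto)
  with cont have "h \<in> bcontfun" by (simp add: bcontfun_def)
  then have app: "apply_bcontfun (Bcontfun h) = h" by (rule Bcontfun_inverse)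
  show thesis
    by (rule that[of "Bcontfun h"]) (use h range in \<open>auto simp: app image_subset_iff\<close>)
qed

lemma apply_bcontfun_sum:
  "apply_bcontfun (\<Sum>i\<in>I. h i) x = (\<Sum>i\<in>I. apply_bcontfun (h i) x)"
  by (induction I rule: infinite_finite_induct) (auto)

text \<open>This stands in for the fact that a measure charges disjoint sets by a total of at most its
  variation: adding the functions with the signs of their images yields a function of norm at most
  one.\<close>
lemma functional_disjoint_sum_bound:
  fixes \<Lambda> :: "('k::topological_space \<Rightarrow>\<^sub>C real) \<Rightarrow> real" and h :: "'i \<Rightarrow> ('k \<Rightarrow>\<^sub>C real)"
  assumes lin: "linear \<Lambda>" and bound: "\<And>y. \<bar>\<Lambda> y\<bar> \<le> B * norm y" and B: "B \<ge> 0"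
    and F: "finite F"
    and le: "\<And>i x. i \<in> F \<Longrightarrow> \<bar>h i x\<bar> \<le> 1"
    and disj: "\<And>i j x. i \<in> F \<Longrightarrow> j \<in> F \<Longrightarrow> i \<noteq> j \<Longrightarrow> h i x = 0 \<or> h j x = 0"
  shows "(\<Sum>i\<in>F. \<bar>\<Lambda> (h i)\<bar>) \<le> B"
proof -
  define y where "y = (\<Sum>i\<in>F. sgn (\<Lambda> (h i)) *\<^sub>R h i)"
  have "norm y \<le> 1"
  proof (rule norm_bound)
    fix x
    have y: "y x = (\<Sum>i\<in>F. sgn (\<Lambda> (h i)) * h i x)"
      by (simp add: y_def apply_bcontfun_sum)
    show "norm (y x) \<le> 1"
    proof (cases "\<exists>i\<in>F. h i x \<noteq> 0")
      case True
      then obtain i where i: "i \<in> F" "h i x \<noteq> 0" by blast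
      have "y x = (\<Sum>j\<in>{i}. sgn (\<Lambda> (h j)) * h j x)"
        unfolding y using i disj F by (intro sum.mono_neutral_right) fastforce+
      also have "\<bar>\<dots>\<bar> \<le> 1 * 1"
        using le[OF i(1), of x] by (simp add: abs_mult abs_sgn_eq)
      finally show ?thesis by simp
    next
      case False
      then have "y x = 0" unfolding y by simp
      then show ?thesis by simp
    qed
  qed
  have "(\<Sum>i\<in>F. \<bar>\<Lambda> (h i)\<bar>) = \<Lambda> y"
    unfolding y_def linear_sum[OF lin] linear_scale[OF lin]
    by (intro sum.cong) (auto simp: abs_sgn mult.commute)
  also have "\<dots> \<le> B * norm y" using bound[of y] by linarith
  also have "\<dots> \<le> B * 1" using \<open>norm y \<le> 1\<close> B by (rule mult_left_mono)
  finally show ?thesis by simp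
qed

text \<open>For each pair \<open>x < y\<close> an intermediate point \<open>w x y\<close> is fixed that neither the interval around \<open>x\<close>
  nor the one around \<open>y\<close> crosses; it exists because one of the two points is internal.\<close>
lemma internal_points_disjoint_intervals:
  fixes F G :: "'l::linorder set"
  assumes fin: "finite F" "finite G" and int: "\<And>t. t \<in> F \<Longrightarrow> internal_point t"
  obtains u v where "\<And>t. t \<in> F \<Longrightarrow> u t < t \<and> t < v t"
    "\<And>s t. s \<in> F \<Longrightarrow> t \<in> F \<Longrightarrow> s < t \<Longrightarrow> v s \<le> u t"
    "\<And>g t. g \<in> G \<Longrightarrow> t \<in> F \<Longrightarrow> g < t \<Longrightarrow> g \<le> u t"
    "\<And>g t. g \<in> G \<Longrightarrow> t \<in> F \<Longrightarrow> t < g \<Longrightarrow> v t \<le> g"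
proof -
  define w where "w x y = (SOME z. x < z \<and> z < y)" for x y :: 'l
  have w: "x < w x y \<and> w x y < y" if "x < y" "x \<in> F \<or> y \<in> F" for x y
  proof -
    have "{x<..<y} \<noteq> {}" using that int unfolding internal_point_def by blast
    then have "\<exists>z. x < z \<and> z < y" by auto
    then show ?thesis unfolding w_def by (rule someI_ex)
  qed
  have "\<exists>p q. p < t \<and> t < q" if "t \<in> F" for t
    using int[OF that] by (auto simp: internal_point_def not_le)
  then obtain p q where pq: "\<And>t. t \<in> F \<Longrightarrow> p t < t \<and> t < q t" by metis
  define u where "u t = Max (insert (p t) ((\<lambda>x. w x t) ` {x\<in>F \<union> G. x < t}))" for t
  define v where "v t = Min (insert (q t) ((\<lambda>x. w t x) ` {x\<in>F \<union> G. t < x}))" for t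
  have u: "w x t \<le> u t" if "x \<in> F \<union> G" "x < t" for x t
    unfolding u_def using fin that by (intro Max_ge) auto
  have v: "v t \<le> w t x" if "x \<in> F \<union> G" "t < x" for x t
    unfolding v_def using fin that by (intro Min_le) auto
  show thesis
  proof (rule that)
    show "u t < t \<and> t < v t" if "t \<in> F" for t
      unfolding u_def v_def using fin that w pq by (auto simp: Max_less_iff Min_gr_iff)
    show "v s \<le> u t" if "s \<in> F" "t \<in> F" "s < t" for s t
      using v[of t s] u[of s t] that by auto
    show "g \<le> u t" if "g \<in> G" "t \<in> F" "g < t" for g t
      using u[of g t] w[of g t] that by force
    show "v t \<le> g" if "g \<in> G" "t \<in> F" "t < g" for g t
      using v[of g t] w[of t g] that by force
  qed
qed

text \<open>Let \<open>\<Lambda>\<close> extend the functional \<open>\<delta>\<^sub>q - \<delta>\<^sub>p\<close> on \<open>C(L)\<close> to \<open>C(K)\<close>, and let \<open>f t\<close> be a continuous step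
  that rises inside the fibre of \<open>t\<close>. The expected value of \<open>\<Lambda>\<close> at \<open>f t\<close> is what
  \<open>\<delta>\<^sub>q - \<delta>\<^sub>p\<close> assigns to the step at \<open>t\<close> on \<open>L\<close>. A deviation means that \<open>\<Lambda>\<close> does not vanish on
  \<open>f t - g t \<circ> \<phi>\<close>, where \<open>g t\<close> is a continuous approximation to that step which equals it off a small
  interval around \<open>t\<close>. For distinct \<open>t\<close> these differences can be given disjoint supports, so there
  are few large deviations.\<close>
lemma finite_exceptional_points:
  fixes \<phi> :: "'k::linorder_topology \<Rightarrow> 'l::linorder_topology"
    and \<Lambda> :: "('k \<Rightarrow>\<^sub>C real) \<Rightarrow> real" and f :: "'l \<Rightarrow> ('k \<Rightarrow>\<^sub>C real)"
  assumes L: "compact (UNIV :: 'l set)" and \<phi>: "continuous_on UNIV \<phi>" "mono \<phi>"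
    and lin: "linear \<Lambda>" and bound: "\<And>y. \<bar>\<Lambda> y\<bar> \<le> B * norm y" and B: "B \<ge> 0"
    and ext: "\<And>g. \<Lambda> (composition_operator \<phi> g) = apply_bcontfun g q - apply_bcontfun g p"
    and T: "\<And>t. t \<in> T \<Longrightarrow> internal_point t" "p \<notin> T" "q \<notin> T"
    and f01: "\<And>t x. t \<in> T \<Longrightarrow> 0 \<le> f t x \<and> f t x \<le> 1"
    and f: "\<And>t x. t \<in> T \<Longrightarrow> \<phi> x < t \<Longrightarrow> f t x = 0" "\<And>t x. t \<in> T \<Longrightarrow> t < \<phi> x \<Longrightarrow> f t x = 1"
    and "\<epsilon> > 0"
  shows "finite {t \<in> T. \<bar>\<Lambda> (f t) - (of_bool (t < q) - of_bool (t < p))\<bar> \<ge> \<epsilon>}"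
proof -
  let ?bad = "{t \<in> T. \<bar>\<Lambda> (f t) - (of_bool (t < q) - of_bool (t < p))\<bar> \<ge> \<epsilon>}"
  have "card F \<le> nat \<lfloor>B / \<epsilon>\<rfloor>" if F: "F \<subseteq> ?bad" "finite F" for F
  proof -
    have int: "internal_point t" if "t \<in> F" for t using that F(1) T(1) by blast
    obtain u v where uv: "\<And>t. t \<in> F \<Longrightarrow> u t < t \<and> t < v t"
      and disj: "\<And>s t. s \<in> F \<Longrightarrow> t \<in> F \<Longrightarrow> s < t \<Longrightarrow> v s \<le> u t"
      and pu: "\<And>g t. g \<in> {p, q} \<Longrightarrow> t \<in> F \<Longrightarrow> g < t \<Longrightarrow> g \<le> u t"
      and pv: "\<And>g t. g \<in> {p, q} \<Longrightarrow> t \<in> F \<Longrightarrow> t < g \<Longrightarrow> v t \<le> g"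
      by (rule internal_points_disjoint_intervals[of F "{p, q}"]) (use F(2) int in auto)
    have "\<exists>g :: 'l \<Rightarrow>\<^sub>C real. (\<forall>x. 0 \<le> g x \<and> g x \<le> 1) \<and> (\<forall>x\<le>u t. g x = 0) \<and> (\<forall>x\<ge>v t. g x = 1)"
      if "t \<in> F" for t
    proof -
      have "u t < v t" using uv[OF that] by auto
      from compact_line_Urysohn[OF L this] show ?thesis by metis
    qed
    then obtain g :: "'l \<Rightarrow> ('l \<Rightarrow>\<^sub>C real)" where
      g01: "\<And>t x. t \<in> F \<Longrightarrow> 0 \<le> g t x \<and> g t x \<le> 1"
      and g0: "\<And>t x. t \<in> F \<Longrightarrow> x \<le> u t \<Longrightarrow> g t x = 0"
      and g1: "\<And>t x. t \<in> F \<Longrightarrow> v t \<le> x \<Longrightarrow> g t x = 1"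
      by metis
    define h where "h t = f t - composition_operator \<phi> (g t)" for t
    have h: "h t x = f t x - g t (\<phi> x)" for t x
      by (simp add: h_def apply_composition_operator[OF \<phi>(1)])
    have supp: "u t < \<phi> x \<and> \<phi> x < v t" if "t \<in> F" "h t x \<noteq> 0" for t x
    proof (rule ccontr)
      assume "\<not> ?thesis"
      then consider "\<phi> x \<le> u t" | "v t \<le> \<phi> x" by fastforce
      then have "h t x = 0"
      proof cases
        case 1
        then have "\<phi> x < t" using uv[OF that(1)] by auto
        then show ?thesis using 1 f(1) g0 that(1) F(1) by (auto simp: h)
      next
        case 2
        then have "t < \<phi> x" using uv[OF that(1)] by auto
        then show ?thesis using 2 f(2) g1 that(1) F(1) by (auto simp: h)
      qed
      with that(2) show False ..
    qed
    have "(\<Sum>t\<in>F. \<bar>\<Lambda> (h t)\<bar>) \<le> B"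
    proof (rule functional_disjoint_sum_bound[OF lin bound B F(2)])
      show "\<bar>h t x\<bar> \<le> 1" if "t \<in> F" for t x
        using f01[of t x] g01[OF that, of "\<phi> x"] that F(1) by (auto simp: h abs_le_iff)
      show "h s x = 0 \<or> h t x = 0" if st: "s \<in> F" "t \<in> F" "s \<noteq> t" for s t x
        using supp[OF st(1), of x] supp[OF st(2), of x] disj[of s t] disj[of t s] st
        by (cases s t rule: linorder_cases) force+
    qed
    moreover have "\<epsilon> \<le> \<bar>\<Lambda> (h t)\<bar>" if t: "t \<in> F" for t
    proof -
      have val: "g t z = of_bool (t < z)" if "z \<in> {p, q}" for z
      proof -
        have "z \<noteq> t" using that t F(1) T(2,3) by blast
        then show ?thesis
          using pu[OF that t] pv[OF that t] g0[OF t, of z] g1[OF t, of z]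
          by (cases z t rule: linorder_cases) auto
      qed
      have "\<Lambda> (h t) = \<Lambda> (f t) - (of_bool (t < q) - of_bool (t < p))"
        unfolding h_def linear_diff[OF lin] ext using val[of p] val[of q] by simp
      then show ?thesis using F(1) t by auto
    qed
    ultimately have "of_nat (card F) * \<epsilon> \<le> B"
      using sum_bounded_below[of F \<epsilon> "\<lambda>t. \<bar>\<Lambda> (h t)\<bar>"] by auto
    then show ?thesis using \<open>\<epsilon> > 0\<close> by (simp add: field_simps le_nat_floor)
  qed
  then show ?thesis by (rule finite_if_finite_subsets_card_bdd[THEN conjunct1])
qed

section \<open>Lifting a weak*-null sequence\<close>

lemma apply_Bcontfun_null_sequence:
  fixes a :: "nat \<Rightarrow> real"
  assumes "a \<longlonglongrightarrow> 0"
  shows "apply_bcontfun (Bcontfun a) = a" "Bcontfun a \<in> c0"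
proof -
  have "bounded (range a)" using assms by (intro convergent_imp_bounded)
  then have "a \<in> bcontfun" by (simp add: bcontfun_def)
  then show "apply_bcontfun (Bcontfun a) = a" by (rule Bcontfun_inverse)
  with assms show "Bcontfun a \<in> c0" by (simp add: c0_def)
qed

text \<open>The \<open>c\<^sub>0\<close>-extension property in terms of a weak*-null sequence of measures
  \<open>\<delta>\<^bsub>q n\<^esub> - \<delta>\<^bsub>p n\<^esub>\<close> on \<open>L\<close>: it lifts to a bounded weak*-null sequence of functionals on
  \<open>C(K)\<close>.\<close>
lemma c0_extension_of_differences:
  fixes \<phi> :: "'k::topological_space \<Rightarrow> 'l::topological_space"
  assumes \<phi>: "continuous_on UNIV \<phi>" "surj \<phi>" and ext: "c0_extension_map \<phi>"
    and null: "\<And>g :: 'l \<Rightarrow>\<^sub>C real. (\<lambda>n. g (q n) - g (p n)) \<longlonglongrightarrow> 0"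
  obtains S :: "('k \<Rightarrow>\<^sub>C real) \<Rightarrow> (nat \<Rightarrow>\<^sub>C real)"
  where "bounded_linear S" "\<And>y. (\<lambda>n. S y n) \<longlonglongrightarrow> 0"
    "\<And>g n. S (composition_operator \<phi> g) n = apply_bcontfun g (q n) - apply_bcontfun g (p n)"
proof -
  let ?Y = "range (composition_operator \<phi> :: ('l \<Rightarrow>\<^sub>C real) \<Rightarrow> ('k \<Rightarrow>\<^sub>C real))"
  note app = apply_composition_operator[OF \<phi>(1)]
  \<comment> \<open>Evaluating at chosen preimages defines the operator without inverting composition with \<open>\<phi>\<close>.\<close>
  define \<sigma> where "\<sigma> = inv \<phi>"
  have \<sigma>: "\<phi> (\<sigma> t) = t" for t using \<phi>(2) by (simp add: \<sigma>_def surj_f_inv_f)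
  define T :: "('k \<Rightarrow>\<^sub>C real) \<Rightarrow> (nat \<Rightarrow>\<^sub>C real)" where
    "T y = Bcontfun (\<lambda>n. y (\<sigma> (q n)) - y (\<sigma> (p n)))" for y
  have lim: "(\<lambda>n. y (\<sigma> (q n)) - y (\<sigma> (p n))) \<longlonglongrightarrow> 0" if "y \<in> ?Y" for y
    using that null by (auto simp: app \<sigma>)
  have T: "apply_bcontfun (T y) n = y (\<sigma> (q n)) - y (\<sigma> (p n))" if "y \<in> ?Y" for y n
    unfolding T_def apply_Bcontfun_null_sequence(1)[OF lim[OF that]] ..
  have sub: "subspace ?Y" using range_composition_operator(1)[OF \<phi>] .
  have "bounded_linear_on ?Y T"
    unfolding bounded_linear_on_def
  proof (intro conjI ballI allI exI)
    fix x y assume xy: "x \<in> ?Y" "y \<in> ?Y"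
    show "T (x + y) = T x + T y"
      by (rule bcontfun_eqI) (simp add: T[OF xy(1)] T[OF xy(2)] T[OF subspace_add[OF sub xy]])
  next
    fix a x assume x: "x \<in> ?Y"
    show "T (a *\<^sub>R x) = a *\<^sub>R T x"
      by (rule bcontfun_eqI)
        (simp add: T[OF x] T[OF subspace_scale[OF sub x]] right_diff_distrib)
  next
    fix x assume x: "x \<in> ?Y"
    show "norm (T x) \<le> 2 * norm x"
    proof (rule norm_bound)
      fix n
      show "norm (apply_bcontfun (T x) n) \<le> 2 * norm x"
        unfolding T[OF x] using norm_bounded[of x "\<sigma> (q n)"] norm_bounded[of x "\<sigma> (p n)"] by simp
    qed
  qed
  moreover have "T ` ?Y \<subseteq> c0"
    unfolding T_def using apply_Bcontfun_null_sequence(2)[OF lim] by (rule image_subsetI)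
  ultimately have "\<exists>S. bounded_linear S \<and> range S \<subseteq> c0 \<and> (\<forall>y\<in>?Y. S y = T y)"
    using ext unfolding c0_extension_map_def c0_extension_property_in_def by simp
  then obtain S where S: "bounded_linear S" "range S \<subseteq> c0" "\<forall>y\<in>?Y. S y = T y" by (elim exE conjE)
  show thesis
  proof (rule that[OF S(1)])
    show "(\<lambda>n. S y n) \<longlonglongrightarrow> 0" for y
      using S(2) by (auto simp: c0_def)
    show "S (composition_operator \<phi> g) n = apply_bcontfun g (q n) - apply_bcontfun g (p n)" for g n
    proof -
      have Y: "composition_operator \<phi> g \<in> ?Y" by (rule rangeI)
      then have "S (composition_operator \<phi> g) = T (composition_operator \<phi> g)" using S(3) by blast
      then show ?thesis by (simp add: T[OF Y] app \<sigma>)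
    qed
  qed
qed

text \<open>The gaps of all stages, arranged in one sequence. At each stage there are finitely many, so the
  increments of a continuous function over them tend to zero; yet a point of \<open>C\<close> that is missed by \<open>d\<close>
  lies in a gap of every late stage.\<close>
lemma null_difference_sequence:
  fixes C :: "'l::linorder_topology set" and d :: "nat \<Rightarrow> 'l"
  assumes C: "compact C" "\<And>c. c \<in> C \<Longrightarrow> internal_point c"
    and d: "\<And>U :: 'l set. open U \<Longrightarrow> U \<noteq> {} \<Longrightarrow> range d \<inter> U \<noteq> {}"
  obtains p q :: "nat \<Rightarrow> 'l" where "range p \<subseteq> range d" "range q \<subseteq> range d"
    "\<And>g :: 'l \<Rightarrow> real. continuous_on UNIV g \<Longrightarrow> (\<lambda>n. g (q n) - g (p n)) \<longlonglongrightarrow> 0"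
    "\<And>t N. t \<in> C \<Longrightarrow> t \<notin> range d \<Longrightarrow> \<exists>n\<ge>N. p n < t \<and> t < q n"
proof -
  let ?code = "\<lambda>(m, i, j). prod_encode (m, prod_encode (i, j))"
  define dec where "dec n = (fst (prod_decode n), prod_decode (snd (prod_decode n)))" for n
  have code: "?code (dec n) = n" for n by (simp add: dec_def case_prod_unfold)
  have dec: "dec (prod_encode (m, prod_encode (i, j))) = (m, i, j)" for m i j
    by (simp add: dec_def)
  \<comment> \<open>Numbers that encode no gap receive the pair \<open>(d 0, d 0)\<close>, whose increment vanishes.\<close>
  define p where "p n = (case dec n of (m, i, j) \<Rightarrow> if gap d C m i j then d i else d 0)" for n
  define q where "q n = (case dec n of (m, i, j) \<Rightarrow> if gap d C m i j then d j else d 0)" for n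
  show thesis
  proof (rule that[of p q])
    show "range p \<subseteq> range d" "range q \<subseteq> range d"
      by (auto simp: p_def q_def split: prod.splits)
  next
    fix g :: "'l \<Rightarrow> real" assume g: "continuous_on UNIV g"
    show "(\<lambda>n. g (q n) - g (p n)) \<longlonglongrightarrow> 0"
    proof (rule tendstoI)
      fix \<epsilon> :: real assume "\<epsilon> > 0"
      obtain M where M: "\<And>m i j. m \<ge> M \<Longrightarrow> gap d C m i j \<Longrightarrow> \<bar>g (d j) - g (d i)\<bar> < \<epsilon>"
        using gap_oscillation[OF C d g \<open>\<epsilon> > 0\<close>] by blast
      have "{n. \<not> dist (g (q n) - g (p n)) 0 < \<epsilon>} \<subseteq> ?code ` ({..<M} \<times> {..<M} \<times> {..<M})"
      proof
        fix n assume n: "n \<in> {n. \<not> dist (g (q n) - g (p n)) 0 < \<epsilon>}"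
        obtain m i j where mij: "dec n = (m, i, j)" by (cases "dec n")
        have gap: "gap d C m i j"
          using n \<open>\<epsilon> > 0\<close> by (cases "gap d C m i j") (auto simp: p_def q_def mij)
        then have "\<not> M \<le> m"
          using n M[of m i j] by (auto simp: p_def q_def mij dist_real_def)
        with gap have "(m, i, j) \<in> {..<M} \<times> {..<M} \<times> {..<M}" by (auto simp: gap_def)
        moreover have "n = ?code (m, i, j)" using code[of n] mij by simp
        ultimately show "n \<in> ?code ` ({..<M} \<times> {..<M} \<times> {..<M})" by (rule rev_image_eqI)
      qed
      then have "finite {n. \<not> dist (g (q n) - g (p n)) 0 < \<epsilon>}"
        by (rule finite_subset) (intro finite_imageI finite_cartesian_product finite_lessThan)
      then show "eventually (\<lambda>n. dist (g (q n) - g (p n)) 0 < \<epsilon>) sequentially"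
        unfolding cofinite_eq_sequentially[symmetric] eventually_cofinite .
    qed
  next
    fix t N assume t: "t \<in> C" "t \<notin> range d"
    obtain M where M: "\<And>m. m \<ge> M \<Longrightarrow> \<exists>i j. gap d C m i j \<and> d i < t \<and> t < d j"
      using gap_around_point[OF t(1) C(2)[OF t(1)] t(2) d] by blast
    obtain i j where ij: "gap d C (max M N) i j" "d i < t" "t < d j" using M[of "max M N"] by auto
    let ?n = "prod_encode (max M N, prod_encode (i, j))"
    have "N \<le> ?n" using le_prod_encode_1[of "max M N" "prod_encode (i, j)"] by linarith
    moreover have "p ?n = d i" "q ?n = d j" using ij(1) by (simp_all add: p_def q_def dec)
    ultimately show "\<exists>n\<ge>N. p n < t \<and> t < q n" using ij by (intro exI[of _ ?n]) auto
  qed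
qed

theorem proposition3p9:
  fixes \<phi> :: "'k::linorder_topology \<Rightarrow> 'l::linorder_topology"
  assumes "MA_omega1 TYPE(nat set)"
    and "compact (UNIV :: 'k set)"
    and "compact (UNIV :: 'l set)"
    and "continuous_on UNIV \<phi>" and "mono \<phi>" and "surj \<phi>"
    and "separable_space (euclidean :: 'l topology)"
    and "borel_regular TYPE('l)"
    and "c0_extension_map \<phi>"
  shows "countable_type \<phi>"
proof (rule ccontr)
  let ?Q = "{t \<in> multi_fibre_points \<phi>. internal_point t}"
  assume "\<not> countable_type \<phi>"
  then have Q: "uncountable ?Q" by (simp add: countable_type_def)
  have borel: "{x :: 'l. internal_point x} \<in> sets borel"
    using assms(8) by (simp add: borel_regular_def)
  obtain C :: "'l set" where C: "closed C" "C \<subseteq> {x. internal_point x}" "uncountable (C \<inter> ?Q)"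
    by (rule closed_uncountable_trace[OF assms(1) open_fsigma_separable_line[OF assms(7)]
          borel _ Q]) auto
  have compact: "compact C" using compact_Int_closed[OF assms(3) C(1)] by simp
  obtain D :: "'l set" where D: "countable D" "\<And>U. open U \<Longrightarrow> U \<noteq> {} \<Longrightarrow> D \<inter> U \<noteq> {}"
    using separable_dense_set[OF assms(7)] by blast
  have "D \<noteq> {}" using D(2)[of UNIV] by auto
  then obtain d :: "nat \<Rightarrow> 'l" where d: "range d = D"
    using range_from_nat_into[OF _ D(1)] by blast
  obtain p q where pq: "range p \<subseteq> D" "range q \<subseteq> D"
    and null: "\<And>g :: 'l \<Rightarrow> real. continuous_on UNIV g \<Longrightarrow> (\<lambda>n. g (q n) - g (p n)) \<longlonglongrightarrow> 0"
    and often: "\<And>t N. t \<in> C \<Longrightarrow> t \<notin> D \<Longrightarrow> \<exists>n\<ge>N. p n < t \<and> t < q n"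
    by (rule null_difference_sequence[of C d]) (use compact C(2) D(2) d in auto)
  obtain S :: "('k \<Rightarrow>\<^sub>C real) \<Rightarrow> (nat \<Rightarrow>\<^sub>C real)" where S: "bounded_linear S"
    and S0: "\<And>y. (\<lambda>n. S y n) \<longlonglongrightarrow> 0"
    and S_ext: "\<And>g n. S (composition_operator \<phi> g) n = apply_bcontfun g (q n) - apply_bcontfun g (p n)"
    by (rule c0_extension_of_differences[OF assms(4,6,9), where p = p and q = q])
      (auto intro: null)
  obtain B where B: "B \<ge> 0" "\<And>y. norm (S y) \<le> norm y * B"
    using bounded_linear.nonneg_bounded[OF S] by blast
  \<comment> \<open>Points of \<open>D\<close> may occur as \<open>p n\<close> or \<open>q n\<close>, where the step at the point has no unambiguous value.\<close>
  define T where "T = C \<inter> ?Q - D"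
  have T: "t \<in> C" "internal_point t" "t \<in> multi_fibre_points \<phi>" "t \<notin> D" if "t \<in> T" for t
    using that by (auto simp: T_def)
  \<comment> \<open>Two points of the fibre of \<open>t\<close> leave room for a continuous step on \<open>K\<close>.\<close>
  have "\<exists>f :: 'k \<Rightarrow>\<^sub>C real. (\<forall>x. 0 \<le> f x \<and> f x \<le> 1) \<and> (\<forall>x. \<phi> x < t \<longrightarrow> f x = 0) \<and>
      (\<forall>x. t < \<phi> x \<longrightarrow> f x = 1)" if tT: "t \<in> T" for t
  proof -
    obtain x y where "\<phi> x = t" "\<phi> y = t" "x \<noteq> y"
      using T(3)[OF tT] by (auto simp: multi_fibre_points_def)
    then obtain a b where ab: "\<phi> a = t" "\<phi> b = t" "a < b" by (metis linorder_neqE)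
    obtain f :: "'k \<Rightarrow>\<^sub>C real" where f: "\<And>x. 0 \<le> f x" "\<And>x. f x \<le> 1"
      "\<And>x. x \<le> a \<Longrightarrow> f x = 0" "\<And>x. b \<le> x \<Longrightarrow> f x = 1"
      using compact_line_Urysohn[OF assms(2) ab(3)] by blast
    have "x \<le> a" if "\<phi> x < t" for x
      using that ab(1) monoD[OF assms(5), of a x] by (metis leD linear)
    moreover have "b \<le> x" if "t < \<phi> x" for x
      using that ab(2) monoD[OF assms(5), of x b] by (metis leD linear)
    ultimately show ?thesis using f by (intro exI[of _ f]) simp
  qed
  then obtain f :: "'l \<Rightarrow> ('k \<Rightarrow>\<^sub>C real)" where
    f01: "\<And>t x. t \<in> T \<Longrightarrow> 0 \<le> f t x \<and> f t x \<le> 1" and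
    f0: "\<And>t x. t \<in> T \<Longrightarrow> \<phi> x < t \<Longrightarrow> f t x = 0" and
    f1: "\<And>t x. t \<in> T \<Longrightarrow> t < \<phi> x \<Longrightarrow> f t x = 1"
    by metis
  define bad where "bad n k = {t \<in> T. \<bar>S (f t) n - (of_bool (t < q n) - of_bool (t < p n))\<bar>
    \<ge> inverse (real (Suc k))}" for n k
  have "finite (bad n k)" for n k
    unfolding bad_def
  proof (rule finite_exceptional_points[where \<Lambda> = "\<lambda>y. apply_bcontfun (S y) n" and B = B,
        OF assms(3-5)])
    show "linear (\<lambda>y. apply_bcontfun (S y) n)"
      using bounded_linear.linear[OF S] by (auto intro!: linearI simp: linear_add linear_scale)
    show "\<bar>apply_bcontfun (S y) n\<bar> \<le> B * norm y" for y
      using norm_bounded[of "S y" n] B(2)[of y] by (simp add: mult.commute)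
    show "p n \<notin> T" "q n \<notin> T" using pq T(4) by auto
  qed (use B(1) S_ext T f01 f0 f1 in auto)
  then have "countable (\<Union>n k. bad n k)" by (simp add: countable_finite)
  moreover have "uncountable T"
    unfolding T_def using C(3) D(1) by (simp add: uncountable_minus_countable)
  ultimately have "T - (\<Union>n k. bad n k) \<noteq> {}"
    using uncountable_minus_countable[of T] by (metis countable_empty)
  then obtain t where t: "t \<in> T" "\<And>n k. t \<notin> bad n k" by blast
  have val: "S (f t) n = of_bool (t < q n) - of_bool (t < p n)" for n
  proof (rule ccontr)
    assume "\<not> ?thesis"
    then obtain k where "inverse (real (Suc k)) < \<bar>S (f t) n - (of_bool (t < q n) - of_bool (t < p n))\<bar>"
      using reals_Archimedean[of "\<bar>S (f t) n - (of_bool (t < q n) - of_bool (t < p n))\<bar>"] by auto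
    then have "t \<in> bad n k" using t(1) by (simp add: bad_def)
    with t(2) show False by blast
  qed
  \<comment> \<open>The values at \<open>f t\<close> tend to zero, but equal one whenever the \<open>n\<close>-th gap contains \<open>t\<close>.\<close>
  have "\<forall>\<^sub>F n in sequentially. dist (S (f t) n) 0 < 1" using S0[of "f t"] by (rule tendstoD) simp
  then obtain N where N: "\<And>n. n \<ge> N \<Longrightarrow> dist (S (f t) n) 0 < 1"
    by (auto simp: eventually_sequentially)
  obtain n where "n \<ge> N" "p n < t" "t < q n" using often[OF T(1,4)[OF t(1)], of N] by blast
  then show False using N[of n] val[of n] by simp
qed

end
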